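(* Let $(A,[-,-]_A,P,Q)$ be an admissible averaging Lie algebra. Define two multiplications $\succ_A,\prec_A:A\otimes A\to A$ on $A$ by $$x\succ_A y=[P(x),y]_A-Q([x,y]_A),\qquad x\prec_A y=Q([x,y]_A),\qquad\forall x,y\in A.$$ Then $(A,\succ_A,\prec_A)$ is a special type-$a$ pre-Leibniz algebra.
   Context: All vector spaces are finite-dimensional over an algebraically closed field $\mathbb{K}$ of characteristic zero. An averaging Lie algebra $(A,[-,-]_A,P)$ is a Lie algebra $(A,[-,-]_A)$ with an averaging operator, i.e. a linear map $P:A\to A$ such that $[P(x),P(y)]_A=P([P(x),y]_A)$ for all $x,y\in A$. An admissible averaging Lie algebra $(A,[-,-]_A,P,Q)$ is an averaging Lie algebra $(A,[-,-]_A,P)$ together with a linear map $Q:A\to A$ such that $[P(x),Q(y)]_A=Q\big([P(x),y]_A\big)=Q\big([x,Q(y)]_A\big)$ for all $x,y\in A$. A Leibniz algebra is a vector space $A$ with a bilinear multiplication $\circ_A$ such that $x\circ_A(y\circ_A z)=(x\circ_A y)\circ_A z+y\circ_A(x\circ_A z)$ for all $x,y,z\in A$. A special type-$a$ pre-Leibniz algebra (with $a=\begin{pmatrix}1&-1\\-1&0\end{pmatrix}$) is a vector space $A$ with bilinear multiplications $\succ_A,\prec_A$ such that $\prec_A$ is anticommutative ($x\prec_A y=-y\prec_A x$), $(A,\circ_A)$ with $x\circ_A y:=x\succ_A y+x\prec_A y$ is a Leibniz algebra, and $$x\circ_A(y\prec_A z)=(x\circ_A y)\prec_A z+y\prec_A(x\circ_A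 z)=x\prec_A(y\prec_A z),\quad\forall x,y,z\in A.$$ *)

theory Defs
  imports "HOL-Computational_Algebra.Polynomial"
begin

text \<open>The underlying vector space of every algebra below is a whole type \<open>'b\<close> with an explicit
  scalar multiplication. The locales need only a field and a vector space; that the field is
  algebraically closed of characteristic zero and the space finite-dimensional is imposed where
  they are used.\<close>

locale bilinear_multiplication = vector_space scale
  for scale :: "'a::field \<Rightarrow> 'b::ab_group_add \<Rightarrow> 'b" +
  fixes mult :: "'b \<Rightarrow> 'b \<Rightarrow> 'b"
  assumes linear_mult_right: "Vector_Spaces.linear scale scale (\<lambda>y. mult x y)"
    and linear_mult_left: "Vector_Spaces.linear scale scale (\<lambda>x. mult x y)"

locale lie_algebra = bilinear_multiplication scale bracket
  for scale :: "'a::field \<Rightarrow> 'b::ab_group_add \<Rightarrow> 'b"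
    and bracket :: "'b \<Rightarrow> 'b \<Rightarrow> 'b" +
  assumes bracket_self: "bracket x x = 0"
    and jacobi: "bracket x (bracket y z) + bracket y (bracket z x) + bracket z (bracket x y) = 0"

locale averaging_lie_algebra = lie_algebra scale bracket
  for scale :: "'a::field \<Rightarrow> 'b::ab_group_add \<Rightarrow> 'b"
    and bracket :: "'b \<Rightarrow> 'b \<Rightarrow> 'b" +
  fixes P :: "'b \<Rightarrow> 'b"
  assumes linear_P: "Vector_Spaces.linear scale scale P"
    and averaging: "bracket (P x) (P y) = P (bracket (P x) y)"

locale admissible_averaging_lie_algebra = averaging_lie_algebra scale bracket P
  for scale :: "'a::field \<Rightarrow> 'b::ab_group_add \<Rightarrow> 'b"
    and bracket :: "'b \<Rightarrow> 'b \<Rightarrow> 'b"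
    and P :: "'b \<Rightarrow> 'b" +
  fixes Q :: "'b \<Rightarrow> 'b"
  assumes linear_Q: "Vector_Spaces.linear scale scale Q"
    and admissible_left: "bracket (P x) (Q y) = Q (bracket (P x) y)"
    and admissible_right: "Q (bracket (P x) y) = Q (bracket x (Q y))"

locale leibniz_algebra = bilinear_multiplication scale circ
  for scale :: "'a::field \<Rightarrow> 'b::ab_group_add \<Rightarrow> 'b"
    and circ :: "'b \<Rightarrow> 'b \<Rightarrow> 'b" +
  assumes leibniz: "circ x (circ y z) = circ (circ x y) z + circ y (circ x z)"

locale two_bilinear_multiplications =
  succ: bilinear_multiplication scale succ_mult + prec: bilinear_multiplication scale prec_mult
  for scale :: "'a::field \<Rightarrow> 'b::ab_group_add \<Rightarrow> 'b"
    and succ_mult :: "'b \<Rightarrow> 'b \<Rightarrow> 'b"  (infixl \<open>\<succ>\<close> 70)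
    and prec_mult :: "'b \<Rightarrow> 'b \<Rightarrow> 'b"  (infixl \<open>\<prec>\<close> 70)
begin

abbreviation circ_mult :: "'b \<Rightarrow> 'b \<Rightarrow> 'b"  (infixl \<open>\<circ>\<^sub>A\<close> 70)
  where "x \<circ>\<^sub>A y \<equiv> x \<succ> y + x \<prec> y"

end

text \<open>Here \<open>a\<close> is the fixed matrix with rows \<open>(1, -1)\<close> and \<open>(-1, 0)\<close>.\<close>

locale special_type_a_pre_leibniz_algebra = two_bilinear_multiplications scale succ_mult prec_mult
  for scale :: "'a::field \<Rightarrow> 'b::ab_group_add \<Rightarrow> 'b"
    and succ_mult :: "'b \<Rightarrow> 'b \<Rightarrow> 'b"  (infixl \<open>\<succ>\<close> 70)
    and prec_mult :: "'b \<Rightarrow> 'b \<Rightarrow> 'b"  (infixl \<open>\<prec>\<close> 70) +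
  assumes anticommutative: "x \<prec> y = - (y \<prec> x)"
    and leibniz_circ: "leibniz_algebra scale (\<lambda>x y. x \<circ>\<^sub>A y)"
    and circ_derivation: "x \<circ>\<^sub>A (y \<prec> z) = (x \<circ>\<^sub>A y) \<prec> z + y \<prec> (x \<circ>\<^sub>A z)"
    and circ_eq_prec: "(x \<circ>\<^sub>A y) \<prec> z + y \<prec> (x \<circ>\<^sub>A z) = x \<prec> (y \<prec> z)"

end

theory Submission
  imports Defs
begin

text \<open>The Q-terms cancel in the sum of the two products, so x \<circ> y = [P x, y], the
  Leibniz product attached to an averaging operator (\<open>leibniz_algebra_averaging\<close>).
  Everything else rests on \<open>bracket_derivation\<close>: each map [P x, -] is a derivation of
  the bracket. Applying Q to this rule expands Q [P x, [y, z]] into the middle expression of the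
  required chain of equalities. The two admissibility conditions identify Q [P x, [y, z]] with [P x,
  Q [y, z]] and with Q [x, Q [y, z]], which are the two outer expressions.\<close>

lemma (in bilinear_multiplication) bilinear_multiplicationI_linear:
  assumes f: "Vector_Spaces.linear scale scale f"
    and g: "Vector_Spaces.linear scale scale g"
  shows "bilinear_multiplication scale (\<lambda>x y. f (mult (g x) y))"
proof (intro bilinear_multiplication.intro bilinear_multiplication_axioms.intro
    vector_space_axioms)
  fix x
  show "Vector_Spaces.linear scale scale (\<lambda>y. f (mult (g x) y))"
    using Vector_Spaces.linear_compose[OF linear_mult_right f] by (simp add: o_def)
next
  fix y
  show "Vector_Spaces.linear scale scale (\<lambda>x. f (mult (g x) y))"
    using Vector_Spaces.linear_compose[OF Vector_Spaces.linear_compose[OF g linear_mult_left] f] by (simp add: o_def)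
qed

lemma bilinear_multiplication_diff:
  assumes "bilinear_multiplication scale m" and "bilinear_multiplication scale n"
  shows "bilinear_multiplication scale (\<lambda>x y. m x y - n x y)"
proof -
  interpret m: bilinear_multiplication scale m by fact
  interpret n: bilinear_multiplication scale n by fact
  interpret vector_space_pair scale scale by unfold_locales
  show ?thesis
    by (intro bilinear_multiplication.intro bilinear_multiplication_axioms.intro
        m.vector_space_axioms linear_compose_sub m.linear_mult_right m.linear_mult_left
        n.linear_mult_right n.linear_mult_left)
qed

context lie_algebra
begin

lemma bracket_add_right: "bracket x (y + z) = bracket x y + bracket x z"
  by (rule module_hom.add[OF Vector_Spaces.linear.axioms(3)[OF linear_mult_right]])

lemma bracket_add_left: "bracket (x + y) z = bracket x z + bracket y z"
  by (rule module_hom.add[OF Vector_Spaces.linear.axioms(3)[OF linear_mult_left]])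

lemma bracket_minus_right: "bracket x (- y) = - bracket x y"
  by (rule module_hom.neg[OF Vector_Spaces.linear.axioms(3)[OF linear_mult_right]])

text \<open>Polarisation: expanding \<open>bracket_self\<close> at \<open>x + y\<close> leaves only
  the two mixed terms.\<close>

lemma bracket_anticommute: "bracket x y = - bracket y x"
proof -
  have "0 = bracket (x + y) (x + y)"
    by (simp add: bracket_self)
  also have "\<dots> = bracket x y + bracket y x"
    unfolding bracket_add_left bracket_add_right by (simp add: bracket_self add.commute)
  finally show ?thesis
    unfolding eq_neg_iff_add_eq_0 by (rule sym)
qed

text \<open>The Jacobi identity with two terms reordered by anticommutativity; in this form it
  applies directly to brackets with \<open>P x\<close>.\<close>

lemma bracket_derivation:
  "bracket x (bracket y z) = bracket (bracket x y) z + bracket y (bracket x z)"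
proof -
  have "bracket y (bracket z x) = - bracket y (bracket x z)"
    by (subst bracket_anticommute[of z x]) (rule bracket_minus_right)
  moreover have "bracket z (bracket x y) = - bracket (bracket x y) z"
    by (rule bracket_anticommute)
  ultimately show ?thesis
    using jacobi[of x y z] by (simp add: algebra_simps eq_diff_eq)
qed

end

text \<open>Since P [P x, y] = [P x, P y], the Leibniz identity becomes the derivation rule for
  [P x, -] applied to the bracket of \<open>P y\<close> and \<open>z\<close>.\<close>

lemma (in averaging_lie_algebra) leibniz_algebra_averaging:
  "leibniz_algebra scale (\<lambda>x y. bracket (P x) y)"
proof (intro leibniz_algebra.intro leibniz_algebra_axioms.intro)
  show "bilinear_multiplication scale (\<lambda>x y. bracket (P x) y)"
    using bilinear_multiplicationI_linear[OF linear_id linear_P] by simp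
  show "bracket (P x) (bracket (P y) z)
      = bracket (P (bracket (P x) y)) z + bracket (P y) (bracket (P x) z)" for x y z
    by (simp add: bracket_derivation[of "P x" "P y" z] averaging)
qed

theorem (in admissible_averaging_lie_algebra) special_type_a_pre_leibniz_algebra:
  "special_type_a_pre_leibniz_algebra scale
     (\<lambda>x y. bracket (P x) y - Q (bracket x y)) (\<lambda>x y. Q (bracket x y))"
proof (intro special_type_a_pre_leibniz_algebra.intro two_bilinear_multiplications.intro
    special_type_a_pre_leibniz_algebra_axioms.intro)
  show prec: "bilinear_multiplication scale (\<lambda>x y. Q (bracket x y))"
    using bilinear_multiplicationI_linear[OF linear_Q linear_id] by simp
  show "bilinear_multiplication scale (\<lambda>x y. bracket (P x) y - Q (bracket x y))"
    \<comment> \<open>The first product is the Leibniz product minus the second product, so its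
      bilinearity is inherited from these two.\<close>
    by (intro bilinear_multiplication_diff prec leibniz_algebra.axioms(1)
        leibniz_algebra_averaging)
  show "leibniz_algebra scale (\<lambda>x y. bracket (P x) y - Q (bracket x y) + Q (bracket x y))"
    using leibniz_algebra_averaging by simp
next
  fix x y z
  show "Q (bracket x y) = - Q (bracket y x)"
    by (subst bracket_anticommute) (rule module_hom.neg[OF Vector_Spaces.linear.axioms(3)[OF linear_Q]])
  \<comment> \<open>The left side is the common value of all three expressions in the chain, so both
    remaining identities reduce to this equation.\<close>
  have derivation: "Q (bracket (P x) (bracket y z))
      = Q (bracket (bracket (P x) y) z) + Q (bracket y (bracket (P x) z))"
    by (subst bracket_derivation) (rule module_hom.add[OF Vector_Spaces.linear.axioms(3)[OF linear_Q]])
  then show "bracket (P x) (Q (bracket y z)) - Q (bracket x (Q (bracket y z)))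
        + Q (bracket x (Q (bracket y z)))
      = Q (bracket (bracket (P x) y - Q (bracket x y) + Q (bracket x y)) z)
        + Q (bracket y (bracket (P x) z - Q (bracket x z) + Q (bracket x z)))"
    by (simp add: admissible_left)
  show "Q (bracket (bracket (P x) y - Q (bracket x y) + Q (bracket x y)) z)
        + Q (bracket y (bracket (P x) z - Q (bracket x z) + Q (bracket x z)))
      = Q (bracket x (Q (bracket y z)))"
    \<comment> \<open>Read backwards, \<open>admissible_right\<close> replaces the inner Q by P on
      \<open>x\<close>, turning Q [x, Q [y, z]] into Q [P x, [y, z]].\<close>
    using derivation by (simp add: admissible_right[symmetric])
qed

theorem proposition3p29:
  fixes scale :: "'k::{alg_closed_field,field_char_0} \<Rightarrow> 'v::ab_group_add \<Rightarrow> 'v"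
    and B :: "'v set"
    and bracket :: "'v \<Rightarrow> 'v \<Rightarrow> 'v"
    and P Q :: "'v \<Rightarrow> 'v"
  assumes "finite_dimensional_vector_space scale B"
    and "admissible_averaging_lie_algebra scale bracket P Q"
  shows "special_type_a_pre_leibniz_algebra scale
           (\<lambda>x y. bracket (P x) y - Q (bracket x y))
           (\<lambda>x y. Q (bracket x y))"
  using assms(2) by (rule admissible_averaging_lie_algebra.special_type_a_pre_leibniz_algebra)

end
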